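(* (a) The Thue-Morse word has exactly 41 balanced factors. The longest is of length $8$. The Thue-Morse word has unbalanced factors of length $n$ exactly when $n\ge 4$. (b) The Rudin-Shapiro word has exactly 157 balanced factors. The longest is of length $12$. The Rudin-Shapiro word has unbalanced factors of length $n$ exactly when $n\ge 4$. (c) The ordinary paperfolding word has exactly 51 balanced factors. The longest is of length $8$. The ordinary paperfolding word has unbalanced factors of length $n$ exactly when $n\ge 4$. (d) The period-doubling word has exactly 69 balanced factors. The longest is of length $15$. The period-doubling word has unbalanced factors of length $n$ exactly when $n\ge 6$. (e) All factors of the Fibonacci word are balanced.
   Context: $|y|_a$ is the number of occurrences of the letter $a$ in $y$. A word $x$ is balanced if, for all factors $y,z$ of $x$ of the same length and all letters $a$ of the alphabet, $\bigl||y|_a-|z|_a\bigr|\le 1$; otherwise it is unbalanced. Factors are finite contiguous blocks, counted as distinct words; the empty word is a factor and is included in the counts. Sequences: - Thue-Morse: the fixed point starting with $0$ of the morphism $0\to01$, $1\to10$. - Rudin-Shapiro ($00010010\cdots$): the image under the coding $n\mapsto\lfloor n/2\rfloor$ of the fixed point starting with $0$ of $0\to01$, $1\to02$, $2\to31$, $3\to32$. - Ordinary paperfolding ($00100110\cdots$): $p_{2n+1}=p_n$, $p_{4n}=0$, $p_{4n+2}=1$ for all $n\ge0$. - Period-doubling ($10111010\cdots$): the fixed point starting with $1$ of $1\to10$, $0\to11$. - Fibonacci ($01001010\cdots$): the fixed point starting with $0$ of $0\to01$, $1\to0$. *)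

theory Defs
  imports Main "HOL-Library.Sublist"
begin

text \<open>
  Letters are natural numbers, finite words are lists and infinite words are functions from
  \<^typ>\<open>nat\<close>. A morphism is given by its images of single letters; its values on
  numbers outside the alphabet at hand are irrelevant.
\<close>

definition infinite_factors :: "(nat \<Rightarrow> 'a) \<Rightarrow> 'a list set" where
  "infinite_factors w = {map w [i..<i + n] | i n. True}"

definition balanced :: "'a list \<Rightarrow> bool" where
  "balanced x \<longleftrightarrow> (\<forall>y z a. sublist y x \<longrightarrow> sublist z x \<longrightarrow> length y = length z \<longrightarrow>
      \<bar>int (count_list y a) - int (count_list z a)\<bar> \<le> 1)"

definition balanced_factors :: "(nat \<Rightarrow> 'a) \<Rightarrow> 'a list set" where
  "balanced_factors w = {x \<in> infinite_factors w. balanced x}"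

definition has_unbalanced_factor_of_length :: "(nat \<Rightarrow> 'a) \<Rightarrow> nat \<Rightarrow> bool" where
  "has_unbalanced_factor_of_length w n \<longleftrightarrow>
     (\<exists>x \<in> infinite_factors w. length x = n \<and> \<not> balanced x)"

text \<open>
  The image of an infinite word under a morphism without empty images: then the image of the
  prefix of length \<^term>\<open>Suc i\<close> has length at least \<^term>\<open>Suc i\<close>, so position \<^term>\<open>i\<close> can be
  read off from it.
\<close>

definition morphic_image :: "('a \<Rightarrow> 'b list) \<Rightarrow> (nat \<Rightarrow> 'a) \<Rightarrow> nat \<Rightarrow> 'b" where
  "morphic_image h w i = concat (map h (map w [0..<Suc i])) ! i"

definition fixed_point_from :: "('a \<Rightarrow> 'a list) \<Rightarrow> 'a \<Rightarrow> nat \<Rightarrow> 'a" where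
  "fixed_point_from h a = (THE w. w 0 = a \<and> morphic_image h w = w)"

lemma length_concat_map_ge:
  assumes "\<And>b. h b \<noteq> []"
  shows "length (concat (map h xs)) \<ge> length xs"
proof (induction xs)
  case (Cons x xs)
  have "length (h x) \<ge> 1" using assms[of x] by (simp add: Suc_le_eq)
  with Cons show ?case by simp
qed simp

lemma ex1_fixed_point:
  assumes ne: "\<And>b. h b \<noteq> []" and ha: "h a = a # u" and u: "u \<noteq> []"
  shows "\<exists>!w. w 0 = a \<and> morphic_image h w = w"
proof -
  have long: "length (concat (map h (map w [0..<Suc n]))) \<ge> Suc (Suc n)" if "w 0 = a" for w n
  proof -
    have eq: "map h (map w [0..<Suc n]) = h a # map h (map w [1..<Suc n])"
      using that by (simp add: upt_conv_Cons del: upt_Suc)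
    have "length (h a) \<ge> 2" using u by (simp add: ha Suc_le_eq)
    moreover have "length (concat (map h (map w [1..<Suc n]))) \<ge> n"
      using length_concat_map_ge[OF ne, of "map w [1..<Suc n]"] by (simp del: upt_Suc)
    ultimately show ?thesis unfolding eq by simp
  qed
  have step: "morphic_image h w (Suc n) = concat (map h (map w [0..<Suc n])) ! Suc n"
    if "w 0 = a" for w n
  proof -
    have "concat (map h (map w [0..<Suc (Suc n)])) =
        concat (map h (map w [0..<Suc n])) @ h (w (Suc n))"
      by simp
    then show ?thesis
      unfolding morphic_image_def
      using long[of w n, OF that] by (simp add: nth_append del: upt_Suc)
  qed
  have zero: "morphic_image h w 0 = a" if "w 0 = a" for w
    using that by (simp add: morphic_image_def ha)
  define P where "P = rec_nat [a] (\<lambda>n p. p @ [concat (map h p) ! Suc n])"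
  have P0: "P 0 = [a]" and PS: "P (Suc n) = P n @ [concat (map h (P n)) ! Suc n]" for n
    by (simp_all add: P_def)
  define w where "w n = P n ! n" for n
  have lP: "length (P n) = Suc n" for n by (induction n) (simp_all add: P0 PS)
  have Pw: "P n = map w [0..<Suc n]" for n
  proof (induction n)
    case (Suc n)
    have "w (Suc n) = concat (map h (P n)) ! Suc n"
      by (simp add: w_def PS nth_append lP)
    then have "P (Suc n) = P n @ [w (Suc n)]" by (simp add: PS)
    with Suc show ?case by simp
  qed (simp add: P0 w_def)
  have w0: "w 0 = a" by (simp add: w_def P0)
  have "morphic_image h w n = w n" for n
  proof (cases n)
    case (Suc m)
    have "w (Suc m) = concat (map h (P m)) ! Suc m"
      by (simp add: w_def PS nth_append lP)
    then show ?thesis using step[of w m, OF w0] Suc Pw[of m] by (simp del: upt_Suc)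
  qed (simp add: zero w0)
  then have ex: "w 0 = a \<and> morphic_image h w = w" using w0 by auto
  show ?thesis
  proof (rule ex1I[of _ w])
    show "w 0 = a \<and> morphic_image h w = w" by (rule ex)
  next
    fix v assume v: "v 0 = a \<and> morphic_image h v = v"
    have "v n = w n" for n
    proof (induction n rule: less_induct)
      case (less n)
      show ?case
      proof (cases n)
        case (Suc m)
        have "map v [0..<Suc m] = map w [0..<Suc m]"
          using less Suc by (intro map_cong) auto
        then have "morphic_image h v (Suc m) = morphic_image h w (Suc m)"
          using step[of v m] step[of w m] v w0 by (simp del: upt_Suc map_map map_eq_conv)
        then show ?thesis using v ex Suc by metis
      qed (use v w0 in simp)
    qed
    then show "v = w" by auto
  qed
qed

definition thue_morse :: "nat \<Rightarrow> nat" where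
  "thue_morse = fixed_point_from (\<lambda>c. if c = 0 then [0, 1] else [1, 0]) 0"

definition rudin_shapiro :: "nat \<Rightarrow> nat" where
  "rudin_shapiro i =
     fixed_point_from
       (\<lambda>c. if c = 0 then [0, 1] else if c = 1 then [0, 2] else if c = 2 then [3, 1] else [3, 2])
       (0 :: nat) i div 2"

function paperfolding :: "nat \<Rightarrow> nat" where
  "paperfolding n =
     (if odd n then paperfolding (n div 2) else if n mod 4 = 0 then 0 else 1)"
  by auto
termination
  by (relation "measure id") (auto elim: oddE)

declare paperfolding.simps [simp del]

lemma paperfolding_rec:
  "paperfolding (2 * n + 1) = paperfolding n"
  "paperfolding (4 * n) = 0"
  "paperfolding (4 * n + 2) = 1"
proof -
  show "paperfolding (2 * n + 1) = paperfolding n"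
    by (subst paperfolding.simps) simp
  show "paperfolding (4 * n) = 0"
    by (subst paperfolding.simps) simp
  have "(4 * n + 2) mod 4 = 2" by presburger
  then show "paperfolding (4 * n + 2) = 1"
    by (subst paperfolding.simps) simp
qed

definition period_doubling :: "nat \<Rightarrow> nat" where
  "period_doubling = fixed_point_from (\<lambda>c. if c = 1 then [1, 0] else [1, 1]) 1"

definition fibonacci_word :: "nat \<Rightarrow> nat" where
  "fibonacci_word = fixed_point_from (\<lambda>c. if c = 0 then [0, 1] else [0]) 0"

end

theory Submission
  imports Defs
begin

text \<open>
  The first four words are codings of fixed points \<open>u\<close> of morphisms with images of length two. A
  factor of \<open>u\<close> of length at most \<open>2 ^ k + 1\<close> lies in the \<open>k\<close>-fold image of two adjacent letters.
  If all pairs of adjacent letters occur before position \<open>J\<close>, then all these factors start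
  before position \<open>J * 2 ^ k\<close>, so they can be listed. A balanced word has balanced factors, so the
  list of balanced factors is complete once a length without balanced factors is reached. For the
  Fibonacci word, the letters of the word are the gaps between its zeros, which turns an
  unbalanced pair of windows into a shorter one.
\<close>

section \<open>Balanced words\<close>

lemma sublist_iff_prefix_suffix: "sublist z x \<longleftrightarrow> (\<exists>v. suffix v x \<and> prefix z v)"
  unfolding sublist_def suffix_def prefix_def by (metis append.assoc)

lemma balanced_Nil: "balanced []"
  by (simp add: balanced_def)

lemma balanced_sublist: "balanced x \<Longrightarrow> sublist y x \<Longrightarrow> balanced y"
  unfolding balanced_def using sublist_order.order_trans by blast

text \<open>Reversal maps factors to factors and keeps lengths and letter counts. It is needed
  because the enumeration produces reversed words.\<close>

lemma balanced_rev: "balanced (rev x) \<longleftrightarrow> balanced x"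
proof -
  have "balanced (rev y)" if "balanced y" for y :: "'a list"
    unfolding balanced_def
  proof (intro allI impI)
    fix z z' a assume "sublist z (rev y)" "sublist z' (rev y)" "length z = length z'"
    then show "\<bar>int (count_list z a) - int (count_list z' a)\<bar> \<le> 1"
      using that[unfolded balanced_def, rule_format, of "rev z" "rev z'" a]
      by (simp add: sublist_rev_left)
  qed
  from this[of x] this[of "rev x"] show ?thesis by auto
qed

text \<open>
  \<open>agree a d u v\<close> reads \<open>u\<close> and \<open>v\<close> in parallel and keeps in \<open>d\<close> the surplus of letters \<open>a\<close> in
  the part of \<open>u\<close> read so far; it fails when the surplus leaves \<open>{-1, 0, 1}\<close>.
\<close>

fun agree :: "'a \<Rightarrow> int \<Rightarrow> 'a list \<Rightarrow> 'a list \<Rightarrow> bool" where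
  "agree a d (b # u) (c # v) =
     (if b = c then agree a d u v else if b = a then d \<le> 0 \<and> agree a (d + 1) u v
      else if c = a then d \<ge> 0 \<and> agree a (d - 1) u v else agree a d u v)"
| "agree a d u v = True"

lemma agree_iff:
  assumes "\<bar>d\<bar> \<le> 1"
  shows "agree a d u v \<longleftrightarrow>
    (\<forall>y z. prefix y u \<longrightarrow> prefix z v \<longrightarrow> length y = length z \<longrightarrow>
       \<bar>d + int (count_list y a) - int (count_list z a)\<bar> \<le> 1)"
  using assms
proof (induction a d u v rule: agree.induct)
  case (1 a d b u c v)
  let ?Q = "\<lambda>d u v. \<forall>y z. prefix y u \<longrightarrow> prefix z v \<longrightarrow> length y = length z \<longrightarrow>
       \<bar>d + int (count_list y a) - int (count_list z a)\<bar> \<le> 1"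
  \<comment> \<open>The surplus after reading \<open>b\<close> and \<open>c\<close>. Since |d| <= 1,
    the sign tests in \<open>agree\<close> amount to |e| <= 1.\<close>
  define e where "e = d + of_bool (b = a) - of_bool (c = a)"
  have step: "?Q d (b # u) (c # v) \<longleftrightarrow> ?Q e u v"
  proof
    assume L: "?Q d (b # u) (c # v)"
    show "?Q e u v"
    proof (intro allI impI)
      fix y z assume "prefix y u" "prefix z v" "length y = length z"
      then show "\<bar>e + int (count_list y a) - int (count_list z a)\<bar> \<le> 1"
        using L[rule_format, of "b # y" "c # z"] by (auto simp: e_def algebra_simps split: if_splits)
    qed
  next
    assume R: "?Q e u v"
    show "?Q d (b # u) (c # v)"
    proof (intro allI impI)
      fix y z assume *: "prefix y (b # u)" "prefix z (c # v)" "length y = length z"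
      show "\<bar>d + int (count_list y a) - int (count_list z a)\<bar> \<le> 1"
      proof (cases y)
        case Nil
        then show ?thesis using * 1(5) by simp
      next
        case (Cons b' y')
        then obtain z' where "z = c # z'" using * by (cases z) auto
        then show ?thesis using * Cons R[rule_format, of y' z']
          by (auto simp: e_def algebra_simps split: if_splits)
      qed
    qed
  qed
  have e: "\<bar>e\<bar> \<le> 1" if "?Q e u v"
    using that[rule_format, of "[]" "[]"] by simp
  have agr: "agree a d (b # u) (c # v) \<longleftrightarrow> \<bar>e\<bar> \<le> 1 \<and> agree a e u v"
    using 1(5) by (auto simp: e_def)
  have "agree a e u v \<longleftrightarrow> ?Q e u v" if "\<bar>e\<bar> \<le> 1"
  proof -
    consider "b = c" | "b \<noteq> c" "b = a" | "b \<noteq> c" "b \<noteq> a" "c = a" | "b \<noteq> c" "b \<noteq> a" "c \<noteq> a"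
      by blast
    then show ?thesis
    proof cases
      case 1
      then have "e = d" by (simp add: e_def)
      with "1.IH"(1) 1 that show ?thesis by blast
    next
      case 2
      then have "e = d + 1" by (simp add: e_def)
      with "1.IH"(2) 2 that show ?thesis by blast
    next
      case 3
      then have "e = d - 1" by (simp add: e_def)
      with "1.IH"(3) 3 that show ?thesis by blast
    next
      case 4
      then have "e = d" by (simp add: e_def)
      with "1.IH"(4) 4 that show ?thesis by blast
    qed
  qed
  with e agr step show ?case by blast
qed auto

text \<open>Factors of \<open>c # x\<close> that are not factors of \<open>x\<close> are prefixes,
  and two prefixes of equal length coincide. So it remains to compare prefixes with factors of
  \<open>x\<close>, which are the prefixes of its suffixes. Letters outside \<open>A\<close> do not
  occur.\<close>

lemma balanced_Cons:
  assumes A: "set (c # x) \<subseteq> A"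
  shows "balanced (c # x) \<longleftrightarrow>
     balanced x \<and> (\<forall>a \<in> A. \<forall>v \<in> set (suffixes x). agree a 0 (c # x) v)"
proof
  assume b: "balanced (c # x)"
  have "sublist y (c # x)" if "sublist y x" for y
    using that by (auto simp: sublist_Cons_right)
  then have "balanced x" using b unfolding balanced_def by blast
  moreover have "agree a 0 (c # x) v" if v: "v \<in> set (suffixes x)" for v a
  proof -
    have "sublist z (c # x)" if "prefix z v" for z
      using that v sublist_iff_prefix_suffix[of z x] by (auto simp: sublist_Cons_right)
    then show ?thesis using b unfolding balanced_def by (subst agree_iff) auto
  qed
  ultimately show "balanced x \<and> (\<forall>a \<in> A. \<forall>v \<in> set (suffixes x). agree a 0 (c # x) v)"
    by blast
next
  assume r: "balanced x \<and> (\<forall>a \<in> A. \<forall>v \<in> set (suffixes x). agree a 0 (c # x) v)"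
  have mixed: "\<bar>int (count_list y a) - int (count_list z a)\<bar> \<le> 1"
    if "prefix y (c # x)" "sublist z x" "length y = length z" for y z a
  proof (cases "a \<in> A")
    case True
    from that obtain v where v: "suffix v x" "prefix z v"
      by (auto simp: sublist_iff_prefix_suffix)
    then have "agree a 0 (c # x) v" using r True by (simp del: agree.simps)
    then show ?thesis using that v by (subst (asm) agree_iff) auto
  next
    case False
    have "a \<notin> set y" "a \<notin> set z"
      using False A set_mono_prefix[OF that(1)] set_mono_sublist[OF that(2)] by auto
    then show ?thesis by simp
  qed
  show "balanced (c # x)"
    unfolding balanced_def
  proof (intro allI impI)
    fix y z a assume *: "sublist y (c # x)" "sublist z (c # x)" "length y = length z"
    consider "prefix y (c # x)" "prefix z (c # x)" | "prefix y (c # x)" "sublist z x"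
      | "sublist y x" "prefix z (c # x)" | "sublist y x" "sublist z x"
      using * by (auto simp: sublist_Cons_right)
    then show "\<bar>int (count_list y a) - int (count_list z a)\<bar> \<le> 1"
    proof cases
      case 1
      then have "y = z" using *(3) by (metis prefix_def append_eq_append_conv)
      then show ?thesis by simp
    next
      case 2
      then show ?thesis using mixed * by blast
    next
      case 3
      then show ?thesis using mixed[of z y a] * by simp
    next
      case 4
      then show ?thesis using r * unfolding balanced_def by blast
    qed
  qed
qed

text \<open>Makes \<open>balanced\<close> executable for the evaluations by
  \<open>code_simp\<close>.\<close>

lemma balanced_code [code]:
  "balanced [] = True"
  "balanced (c # x) =
     (balanced x \<and> (\<forall>a \<in> set (c # x). \<forall>v \<in> set (suffixes x). agree a 0 (c # x) v))"
  by (simp_all only: balanced_Nil balanced_Cons[OF subset_refl])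

section \<open>Enumerating the balanced factors\<close>

text \<open>The left quotient of the finite language \<open>T\<close> by the letter
  \<open>b\<close>.\<close>

fun tails :: "'a \<Rightarrow> 'a list list \<Rightarrow> 'a list list" where
  "tails b [] = []"
| "tails b ([] # T) = tails b T"
| "tails b ((c # t) # T) = (if c = b then t # tails b T else tails b T)"

lemma set_tails: "set (tails b T) = {t. b # t \<in> set T}"
  by (induction b T rule: tails.induct) auto

text \<open>
  The words \<open>T\<close> are the possible continuations of the word whose reversal is \<open>r\<close>. Reversed words
  grow at the head, where only the prefixes of \<open>r\<close> have to be compared with other windows.
\<close>

primrec balanced_extensions :: "'a list \<Rightarrow> nat \<Rightarrow> 'a list \<Rightarrow> 'a list list \<Rightarrow> 'a list list" where
  "balanced_extensions A 0 r T = []"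
| "balanced_extensions A (Suc k) r T =
     (if T = [] \<or> \<not> (\<forall>a \<in> set A. \<forall>v \<in> set (suffixes (tl r)). agree a 0 r v) then []
      else r # concat (map (\<lambda>a. balanced_extensions A k (a # r) (tails a T)) A))"

text \<open>Stopping at an unbalanced \<open>r\<close> loses nothing, because \<open>r\<close> is a
  factor of every word below it. As \<open>tl r\<close> is balanced, the test on prefixes of
  \<open>r\<close> decides whether \<open>r\<close> is balanced.\<close>

lemma set_balanced_extensions:
  assumes "balanced (tl r)" "set r \<subseteq> set A" "\<forall>t \<in> set T. set t \<subseteq> set A"
  shows "set (balanced_extensions A k r T) =
    {rev u @ r | u. length u < k \<and> balanced (rev u @ r) \<and> (\<exists>t \<in> set T. prefix u t)}"
  using assms
proof (induction k arbitrary: r T)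
  case (Suc k)
  have check: "(\<forall>a \<in> set A. \<forall>v \<in> set (suffixes (tl r)). agree a 0 r v) \<longleftrightarrow> balanced r"
  proof (cases r)
    case (Cons c x)
    then show ?thesis using Suc.prems balanced_Cons[of c x "set A"] by simp
  qed (simp add: balanced_Nil)
  show ?case
  proof (cases "T \<noteq> [] \<and> balanced r")
    case False
    have "balanced r" if "balanced (rev u @ r)" for u
      using balanced_sublist[OF that] by auto
    with False show ?thesis using check by auto
  next
    case True
    then obtain t0 where t0: "t0 \<in> set T" by (cases T) auto
    have "set (balanced_extensions A k (a # r) (tails a T)) =
        {rev u @ a # r | u. length u < k \<and> balanced (rev u @ a # r) \<and>
          (\<exists>t \<in> set (tails a T). prefix u t)}" if "a \<in> set A" for a
    proof (rule Suc.IH)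
      show "\<forall>t \<in> set (tails a T). set t \<subseteq> set A"
        using Suc.prems(3) by (fastforce simp: set_tails)
    qed (use that True Suc.prems in auto)
    then have "set (balanced_extensions A (Suc k) r T) =
      insert r (\<Union>a \<in> set A. {rev u @ a # r | u. length u < k \<and> balanced (rev u @ a # r) \<and>
          (\<exists>t. a # t \<in> set T \<and> prefix u t)})"
      using True check by (auto simp: set_tails)
    also have "\<dots> = {rev u @ r | u. length u < Suc k \<and> balanced (rev u @ r) \<and>
        (\<exists>t \<in> set T. prefix u t)}" (is "?L = ?R")
    proof (intro subset_antisym subsetI)
      fix x assume "x \<in> ?L"
      then consider "x = r" | a u t where "x = rev u @ a # r" "length u < k"
        "balanced (rev u @ a # r)" "a # t \<in> set T" "prefix u t"
        by blast
      then show "x \<in> ?R"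
      proof cases
        case 1
        then show ?thesis using True t0 by (auto intro: exI[of _ "[]"])
      next
        case 2
        then show ?thesis
          by (auto intro!: exI[of _ "a # u"] bexI[of _ "a # t"])
      qed
    next
      fix x assume "x \<in> ?R"
      then obtain u t where u: "x = rev u @ r" "length u < Suc k" "balanced x" "t \<in> set T"
        "prefix u t" by blast
      show "x \<in> ?L"
      proof (cases u)
        case (Cons a u')
        then obtain t' where t': "t = a # t'" "prefix u' t'" using u by (cases t) auto
        moreover have "a \<in> set A" using u t' Suc.prems by auto
        ultimately show ?thesis using u Cons by auto
      qed (use u in simp)
    qed
    finally show ?thesis .
  qed
qed simp

text \<open>All words in the branch of \<open>a\<close> end in \<open>a # r\<close>, so they are
  longer than \<open>r\<close>, and different branches are disjoint. Hence the length of the list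
  counts words.\<close>

lemma distinct_balanced_extensions:
  assumes "distinct A"
  shows "distinct (balanced_extensions A k r T)"
proof -
  have suffix: "suffix r x" if "x \<in> set (balanced_extensions A k r T)" for x k r T
    using that
  proof (induction k arbitrary: r T)
    case (Suc k)
    have "suffix r x" if "x \<in> set (balanced_extensions A k (a # r) (tails a T))" for a
      using Suc.IH[OF that] by (rule suffix_ConsD)
    with Suc.prems show ?case by (auto split: if_splits)
  qed simp
  have "distinct (concat (map f xs))"
    if "distinct xs" "\<And>a. distinct (f a)" "\<And>a x. x \<in> set (f a) \<Longrightarrow> suffix (a # s) x"
    for f :: "'a \<Rightarrow> 'a list list" and xs s
    using that(1)
  proof (induction xs)
    case (Cons a xs)
    then have "a \<notin> set xs" by simp
    have "suffix (b # s) x \<Longrightarrow> suffix (a # s) x \<Longrightarrow> a = b" for b x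
      by (auto simp: suffix_def)
    then have "set (f a) \<inter> set (f b) = {}" if "a \<noteq> b" for b
      using that \<open>\<And>a x. x \<in> set (f a) \<Longrightarrow> suffix (a # s) x\<close> by blast
    then have "set (f a) \<inter> (\<Union>b \<in> set xs. set (f b)) = {}" using \<open>a \<notin> set xs\<close> by fast
    with Cons that(2) show ?case by simp
  qed simp
  note concat = this
  show ?thesis
  proof (induction k arbitrary: r T)
    case (Suc k)
    have "r \<notin> set (concat (map (\<lambda>a. balanced_extensions A k (a # r) (tails a T)) A))"
      using suffix_length_le[OF suffix, of r] by fastforce
    then show ?case
      using concat[OF assms, of "\<lambda>a. balanced_extensions A k (a # r) (tails a T)" r] Suc.IH suffix
      by simp
  qed simp
qed

text \<open>Reduces all claims to the finite list \<open>T\<close>. Balance passes to shorter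
  windows and imbalance to longer ones, so the lengths \<open>m\<close> and \<open>Suc m\<close>
  determine the threshold.\<close>

lemma balanced_factors_statistics:
  assumes T: "set T = {map w [i..<i + N] | i. True}"
    and A: "distinct A" "range w \<subseteq> set A"
    and c: "length (balanced_extensions A (Suc N) [] T) = c"
    and l: "Max (length ` set (balanced_extensions A (Suc N) [] T)) = l"
    and "l < N" "m < N"
    and short: "\<forall>t \<in> set T. balanced (take m t)"
    and long: "\<exists>t \<in> set T. \<not> balanced (take (Suc m) t)"
  shows "card (balanced_factors w) = c \<and> Max (length ` balanced_factors w) = l \<and>
    (\<forall>n. has_unbalanced_factor_of_length w n \<longleftrightarrow> n \<ge> Suc m)"
proof -
  define B where "B = balanced_extensions A (Suc N) [] T"
  have take_factor: "take n (map w [i..<i + N]) = map w [i..<i + n]" if "n \<le> N" for n i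
    using that by (simp add: take_map)
  have B: "set B = {rev u | u. length u \<le> N \<and> balanced (rev u) \<and> (\<exists>t \<in> set T. prefix u t)}"
    unfolding B_def using A T
    by (subst set_balanced_extensions) (auto simp: balanced_Nil less_Suc_eq_le image_subset_iff)
  have prefix: "(\<exists>t \<in> set T. prefix u t) \<longleftrightarrow> u \<in> infinite_factors w" if "length u \<le> N" for u
  proof
    assume "\<exists>t \<in> set T. prefix u t"
    then obtain i where "prefix u (map w [i..<i + N])" by (auto simp: T)
    then have "u = take (length u) (map w [i..<i + N])"
      by (auto simp: prefix_def)
    then have "u = map w [i..<i + length u]" using take_factor that by simp
    then show "u \<in> infinite_factors w" unfolding infinite_factors_def by blast
  next
    assume "u \<in> infinite_factors w"
    then obtain i n where u: "u = map w [i..<i + n]" unfolding infinite_factors_def by blast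
    then have "u = take n (map w [i..<i + N])" using that take_factor by simp
    moreover have "map w [i..<i + N] \<in> set T" using T by blast
    ultimately show "\<exists>t \<in> set T. prefix u t" by (metis take_is_prefix)
  qed
  have le: "length x \<le> l" if "x \<in> set B" for x
    using that l[folded B_def] by (metis List.finite_set Max_ge finite_imageI imageI)
  \<comment> \<open>Otherwise the prefix of length \<open>N\<close> would be balanced; the
    enumeration reaches length \<open>N\<close> but finds nothing beyond
    \<open>l < N\<close>.\<close>
  have bound: "length x < N" if x: "x \<in> infinite_factors w" "balanced x" for x
  proof (rule ccontr)
    assume "\<not> length x < N"
    obtain i n where i: "x = map w [i..<i + n]" using x unfolding infinite_factors_def by blast
    define y where "y = take N x"
    have y: "y = map w [i..<i + N]" using i \<open>\<not> length x < N\<close> by (simp add: y_def take_map)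
    have "balanced y" using x(2) balanced_sublist[of x y]
      by (simp add: y_def sublist_take)
    then have "rev y \<in> set B" unfolding B using y T balanced_rev by fastforce
    then show False using le[of "rev y"] \<open>l < N\<close> y by simp
  qed
  have bal: "balanced_factors w = rev ` set B"
  proof (intro subset_antisym subsetI)
    fix x assume x: "x \<in> balanced_factors w"
    then have x': "x \<in> infinite_factors w" "balanced x" by (auto simp: balanced_factors_def)
    then have "rev x \<in> set B"
      using bound[OF x'] prefix[of x] by (auto simp: B balanced_rev)
    then show "x \<in> rev ` set B" by force
  next
    fix x assume "x \<in> rev ` set B"
    then have "length x \<le> N" "balanced x" "\<exists>t \<in> set T. prefix x t"
      by (auto simp: B balanced_rev)
    then show "x \<in> balanced_factors w"
      using prefix[of x] by (auto simp: balanced_factors_def)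
  qed
  have "card (balanced_factors w) = c"
    unfolding bal B_def c[symmetric]
    by (simp only: card_image inj_on_rev distinct_card distinct_balanced_extensions A(1))
  moreover have "Max (length ` balanced_factors w) = l"
    unfolding bal B_def l[symmetric] by (simp add: image_image)
  moreover have "has_unbalanced_factor_of_length w n \<longleftrightarrow> n \<ge> Suc m" for n
  proof
    assume "has_unbalanced_factor_of_length w n"
    then obtain i where i: "\<not> balanced (map w [i..<i + n])"
      unfolding has_unbalanced_factor_of_length_def infinite_factors_def by auto
    show "n \<ge> Suc m"
    proof (rule ccontr)
      assume n: "\<not> n \<ge> Suc m"
      have "map w [i..<i + N] \<in> set T" using T by blast
      then have "balanced (take m (map w [i..<i + N]))" using short by blast
      then have "balanced (map w [i..<i + m])" using take_factor[of m i] \<open>m < N\<close> by simp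
      moreover have "map w [i..<i + n] = take n (map w [i..<i + m])"
        using n by (simp add: take_map)
      ultimately show False using i balanced_sublist sublist_take by metis
    qed
  next
    assume n: "n \<ge> Suc m"
    obtain t where t: "t \<in> set T" "\<not> balanced (take (Suc m) t)" using long by blast
    then obtain i where "t = map w [i..<i + N]" unfolding T by blast
    with t(2) have i: "\<not> balanced (map w [i..<i + Suc m])"
      using take_factor[of "Suc m" i] \<open>m < N\<close> by (simp del: upt_Suc)
    have "map w [i..<i + Suc m] = take (Suc m) (map w [i..<i + n])"
      using n by (simp add: take_map del: upt_Suc)
    then have "\<not> balanced (map w [i..<i + n])" using i balanced_sublist sublist_take by metis
    then show "has_unbalanced_factor_of_length w n"
      unfolding has_unbalanced_factor_of_length_def infinite_factors_def by force
  qed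
  ultimately show ?thesis by blast
qed

section \<open>Fixed points of uniform morphisms\<close>

text \<open>The image of \<open>w n\<close> starts where the image of the first \<open>n\<close>
  letters ends.\<close>

lemma morphic_image_nth:
  assumes ne: "\<And>b. h b \<noteq> []" and r: "r < length (h (w n))"
  shows "morphic_image h w (length (concat (map h (map w [0..<n]))) + r) = h (w n) ! r"
proof -
  define k where "k = length (concat (map h (map w [0..<n]))) + r"
  \<comment> \<open>Images are nonempty, so the prefix that \<open>morphic_image\<close> reads for
    position \<open>k\<close> includes the letter \<open>w n\<close>.\<close>
  have "n \<le> k" using length_concat_map_ge[of h, OF ne, of "map w [0..<n]"] by (simp add: k_def)
  then have "[0..<Suc k] = [0..<n] @ n # [Suc n..<Suc k]"
    using upt_add_eq_append[of 0 n "Suc k - n"] by (simp add: upt_conv_Cons del: upt_Suc)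
  then have "concat (map h (map w [0..<Suc k])) =
      concat (map h (map w [0..<n])) @ h (w n) @ concat (map h (map w [Suc n..<Suc k]))"
    by (simp del: upt_Suc)
  then show ?thesis
    using r unfolding morphic_image_def k_def[symmetric] by (simp add: k_def nth_append del: upt_Suc)
qed

lemma fixed_point_from:
  assumes "\<And>b. h b \<noteq> []" "h a = a # u" "u \<noteq> []"
  shows "fixed_point_from h a 0 = a" "morphic_image h (fixed_point_from h a) = fixed_point_from h a"
  using theI'[OF ex1_fixed_point[of h a u, OF assms]] unfolding fixed_point_from_def by blast+

lemma fixed_point_from_doubling:
  assumes len: "\<And>b. length (h b) = 2" and a: "hd (h a) = a"
  defines "u \<equiv> fixed_point_from h a"
  shows "u 0 = a" "h (u n) = [u (2 * n), u (Suc (2 * n))]"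
proof -
  have ne: "h b \<noteq> []" for b using len[of b] by auto
  obtain b where b: "h a = a # [b]" using len[of a] a by (cases "h a") (auto simp: length_Suc_conv)
  note u = fixed_point_from[of h a "[b]", OF ne b, folded u_def, simplified]
  show "u 0 = a" using u by simp
  have "length (concat (map h (map u [0..<n]))) = 2 * n" for n
    by (induction n) (simp_all add: len)
  then have "u (2 * n + r) = h (u n) ! r" if "r < 2" for r
    using morphic_image_nth[of h r u n, OF ne] that u by (simp add: len)
  from this[of 0] this[of 1] show "h (u n) = [u (2 * n), u (Suc (2 * n))]"
    using len[of "u n"] by (auto simp: length_Suc_conv numeral_2_eq_2)
qed

text \<open>An executable prefix of the fixed point starting with \<open>a\<close>.\<close>

definition prefix_word :: "('a \<Rightarrow> 'a list) \<Rightarrow> 'a \<Rightarrow> nat \<Rightarrow> 'a list" where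
  "prefix_word h a k = ((\<lambda>xs. concat (map h xs)) ^^ k) [a]"

text \<open>Windows starting near the end of \<open>P\<close> come out shorter than
  \<open>N\<close>; a length bound in \<open>statistics\<close> excludes them.\<close>

fun windows :: "nat \<Rightarrow> nat \<Rightarrow> 'a list \<Rightarrow> 'a list list" where
  "windows N (Suc M) (x # P) = take N (x # P) # windows N M P"
| "windows N _ _ = []"

lemma set_windows: "set (windows N M P) = {take N (drop i P) | i. i < M \<and> i < length P}"
proof (induction N M P rule: windows.induct)
  case (1 N M x P)
  have "{take N (drop i (x # P)) | i. i < Suc M \<and> i < length (x # P)} =
      insert (take N (x # P)) {take N (drop i P) | i. i < M \<and> i < length P}" (is "?L = ?R")
  proof (intro subset_antisym subsetI)
    fix y assume "y \<in> ?L"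
    then obtain i where "y = take N (drop i (x # P))" "i < Suc M" "i < length (x # P)" by blast
    then show "y \<in> ?R" by (cases i) auto
  next
    fix y assume "y \<in> ?R"
    then consider "y = take N (x # P)"
      | i where "y = take N (drop i P)" "i < M" "i < length P" by blast
    then show "y \<in> ?L"
    proof cases
      case 1
      then show ?thesis by (auto intro: exI[of _ 0])
    next
      case 2
      then show ?thesis by (auto intro!: exI[of _ "Suc i"])
    qed
  qed
  with 1 show ?case by simp
qed auto

section \<open>Recurrence of windows under a doubling morphism\<close>

context
  fixes h :: "'b \<Rightarrow> 'b list" and u :: "nat \<Rightarrow> 'b"
  and a :: 'b
  assumes start: "u 0 = a" and doubling: "\<And>n. h (u n) = [u (2 * n), u (Suc (2 * n))]"
begin

lemma prefix_word_eq: "prefix_word h a k = map u [0..<2 ^ k]"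
proof (induction k)
  case (Suc k)
  have "concat (map h (map u [0..<n])) = map u [0..<2 * n]" for n
    by (induction n) (simp_all add: doubling)
  with Suc show ?case by (simp add: prefix_word_def)
qed (simp add: prefix_word_def start)

text \<open>
  The letter pairs of \<open>u\<close> at positions \<open>2 q\<close> and \<open>2 q + 1\<close> depend only on the pair at \<open>q\<close>;
  so as soon as the first \<open>2 J\<close> pairs all occur among the first \<open>J\<close>, every pair does.
\<close>

lemma pairs_recur:
  assumes J: "0 < J" "2 * J < 2 ^ K"
    and sub: "let Q = prefix_word h a K
      in set (zip (take (2 * J) Q) (tl Q)) \<subseteq> set (zip (take J Q) (tl Q))"
  shows "\<exists>m < J. u m = u n \<and> u (Suc m) = u (Suc n)"
proof -
  \<comment> \<open>The bound \<open>i < 2 ^ K\<close> gives each of the first \<open>i\<close>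
    letters a right neighbour inside the computed prefix.\<close>
  have zip: "zip (take i (prefix_word h a K)) (tl (prefix_word h a K)) =
      map (\<lambda>i. (u i, u (Suc i))) [0..<i]" if "i < 2 ^ K" for i
    using that by (intro nth_equalityI) (auto simp: prefix_word_eq nth_tl)
  have early: "\<exists>m < J. u m = u i \<and> u (Suc m) = u (Suc i)" if "i < 2 * J" for i
    using sub that J by (fastforce simp: Let_def zip)
  show ?thesis
  proof (induction n rule: less_induct)
    case (less n)
    show ?case
    proof (cases "n < J")
      case False
      define q s where "q = n div 2" and "s = n mod 2"
      have n: "n = 2 * q + s" "s < 2" by (simp_all add: q_def s_def)
      have "q < n" using False J by (simp add: q_def)
      then obtain m where m: "m < J" "u m = u q" "u (Suc m) = u (Suc q)" using less by blast
      have "u (2 * m) = u (2 * q)" "u (Suc (2 * m)) = u (Suc (2 * q))"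
        "u (Suc (Suc (2 * m))) = u (Suc (Suc (2 * q)))"
        using doubling[of m] doubling[of q] doubling[of "Suc m"] doubling[of "Suc q"] m by simp_all
      then have "u (2 * m + s) = u n" "u (Suc (2 * m + s)) = u (Suc n)"
        using n by (auto simp: less_2_cases_iff)
      moreover have "2 * m + s < 2 * J" using m n by simp
      ultimately show ?thesis using early by metis
    qed blast
  qed
qed

text \<open>Induction on \<open>k\<close>: the images of the \<open>2 ^ k + 1\<close> letters from
  \<open>n div 2\<close> on cover the \<open>2 ^ Suc k + 1\<close> letters from \<open>n\<close> on.
  So a match for \<open>n div 2\<close> is doubled and shifted by \<open>n mod 2\<close>.\<close>

lemma windows_recur:
  assumes pairs: "\<And>n. \<exists>m < J. u m = u n \<and> u (Suc m) = u (Suc n)"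
  shows "\<exists>m < J * 2 ^ k. \<forall>r \<le> 2 ^ k. u (m + r) = u (n + r)"
proof (induction k arbitrary: n)
  case 0
  from pairs[of n] show ?case by (auto simp: le_Suc_eq)
next
  case (Suc k)
  define q s where "q = n div 2" and "s = n mod 2"
  have n: "n = 2 * q + s" "s < 2" by (simp_all add: q_def s_def)
  from Suc obtain m where m: "m < J * 2 ^ k" "\<And>r. r \<le> 2 ^ k \<Longrightarrow> u (m + r) = u (q + r)" by blast
  have double: "u (2 * (m + r)) = u (2 * (q + r))" "u (Suc (2 * (m + r))) = u (Suc (2 * (q + r)))"
    if "r \<le> 2 ^ k" for r
    using m(2)[OF that] doubling[of "m + r"] doubling[of "q + r"] by simp_all
  have "u (2 * m + s + r) = u (n + r)" if "r \<le> 2 ^ Suc k" for r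
  proof -
    define t where "t = (s + r) div 2"
    \<comment> \<open>The shift \<open>s\<close> is at most 1, so \<open>t\<close> stays in range
      even for \<open>r = 2 ^ Suc k\<close>.\<close>
    have t: "t \<le> 2 ^ k" "s + r = 2 * t \<or> s + r = Suc (2 * t)"
      using that n(2) by (auto simp: t_def)
    then have "2 * m + s + r = 2 * (m + t) \<and> n + r = 2 * (q + t) \<or>
        2 * m + s + r = Suc (2 * (m + t)) \<and> n + r = Suc (2 * (q + t))"
      using n by auto
    then show ?thesis using double[OF t(1)] by metis
  qed
  moreover have "2 * m + s < J * 2 ^ Suc k" using m(1) n(2) by simp
  ultimately show ?case by blast
qed

text \<open>For concrete parameters all hypotheses except those on \<open>u\<close> become finite
  evaluations. The second length bound keeps every window starting before \<open>J * 2 ^ k\<close>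
  inside the computed prefix; by recurrence these are all windows of length
  \<open>N\<close>.\<close>

lemma statistics:
  fixes g :: "'b \<Rightarrow> 'a"
  assumes J: "0 < J" "2 * J < 2 ^ K"
    and sub: "let Q = prefix_word h a K
      in set (zip (take (2 * J) Q) (tl Q)) \<subseteq> set (zip (take J Q) (tl Q))"
    and len: "N \<le> 2 ^ k + 1" "J * 2 ^ k + N \<le> 2 ^ K + 1"
    and A: "distinct A" "\<forall>c \<in> set (take J (prefix_word h a K)). g c \<in> set A"
    and stats: "let T = windows N (J * 2 ^ k) (map g (prefix_word h a K));
        L = map length (balanced_extensions A (Suc N) [] T)
      in length L = c \<and> Max (set L) = l \<and> (\<forall>t \<in> set T. balanced (take m t)) \<and>
        (\<exists>t \<in> set T. \<not> balanced (take (Suc m) t))"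
    and "l < N" "m < N"
  shows "card (balanced_factors (\<lambda>n. g (u n))) = c \<and>
    Max (length ` balanced_factors (\<lambda>n. g (u n))) = l \<and>
    (\<forall>n. has_unbalanced_factor_of_length (\<lambda>n. g (u n)) n \<longleftrightarrow> n \<ge> Suc m)"
proof -
  define T where "T = windows N (J * 2 ^ k) (map g (prefix_word h a K))"
  note pairs = pairs_recur[OF J sub]
  have take_drop: "take N (drop i (map g (prefix_word h a K))) = map (\<lambda>n. g (u n)) [i..<i + N]"
    if "i < J * 2 ^ k" for i
    using that len(2) by (simp add: prefix_word_eq drop_map take_map)
  have *: "set T = {map (\<lambda>n. g (u n)) [i..<i + N] | i. i < J * 2 ^ k}"
  proof -
    have "J * 2 ^ k \<le> 2 ^ K" using len \<open>l < N\<close> by simp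
    then have "set T = {take N (drop i (map g (prefix_word h a K))) | i. i < J * 2 ^ k}"
      unfolding T_def set_windows by (fastforce simp: prefix_word_eq)
    also have "\<dots> = {map (\<lambda>n. g (u n)) [i..<i + N] | i. i < J * 2 ^ k}"
      using take_drop by (intro Collect_cong) metis
    finally show ?thesis .
  qed
  have "map (\<lambda>n. g (u n)) [i..<i + N] \<in> set T" for i
  proof -
    obtain m where m: "m < J * 2 ^ k" "\<And>r. r \<le> 2 ^ k \<Longrightarrow> u (m + r) = u (i + r)"
      using windows_recur[OF pairs] by blast
    then have "map (\<lambda>n. g (u n)) [i..<i + N] = map (\<lambda>n. g (u n)) [m..<m + N]"
      using len(1) by (intro nth_equalityI) auto
    then show ?thesis using m(1) * by blast
  qed
  with * have T: "set T = {map (\<lambda>n. g (u n)) [i..<i + N] | i. True}" by blast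
  have range: "range (\<lambda>n. g (u n)) \<subseteq> set A"
  proof clarify
    fix n
    obtain m where m: "m < J" "u m = u n" using pairs by blast
    have "take J (prefix_word h a K) = map u [0..<J]"
      using J by (simp add: prefix_word_eq take_map)
    then have "u m \<in> set (take J (prefix_word h a K))" using m(1) by simp
    then show "g (u n) \<in> set A" using A m(2) by auto
  qed
  from stats have stats: "length (balanced_extensions A (Suc N) [] T) = c"
    "Max (length ` set (balanced_extensions A (Suc N) [] T)) = l"
    "\<forall>t \<in> set T. balanced (take m t)" "\<exists>t \<in> set T. \<not> balanced (take (Suc m) t)"
    unfolding T_def Let_def list.set_map length_map by blast+
  show ?thesis
    by (rule balanced_factors_statistics[OF T A(1) range stats(1,2) \<open>l < N\<close> \<open>m < N\<close> stats(3,4)])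
qed

end

section \<open>The Fibonacci word\<close>

text \<open>
  The \<open>k\<close>-th zero of the Fibonacci word starts the image of its \<open>k\<close>-th letter, hence sits at
  position \<open>k + zeros k\<close>. So two windows of length \<open>L\<close> with at most \<open>a\<close> and at least \<open>a + 2\<close>
  zeros yield two windows of length \<open>a + 1 < L\<close> whose zeros differ by at least two.
\<close>

lemma windows_balanced_of_positions:
  fixes Z :: "nat \<Rightarrow> nat"
  assumes mono: "mono Z" and Z0: "Z 0 = 0" and step: "\<And>n. Z (Suc n) \<le> Suc (Z n)"
    and position: "\<And>k n. k + Z k < n \<longleftrightarrow> k < Z n"
  shows "Z (j + L) + Z i \<le> Z (i + L) + Z j + 1"
proof (induction L arbitrary: i j rule: less_induct)
  case (less L)
  show ?case
  proof (rule ccontr)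
    assume "\<not> ?thesis"
    define a where "a = Z (i + L) - Z i"
    have a: "Z (i + L) = Z i + a" using mono by (simp add: a_def monoD)
    with \<open>\<not> ?thesis\<close> have b: "Z j + a + 2 \<le> Z (j + L)" by simp
    have grow: "Z (j + n) \<le> Z j + n" for n
      by (induction n) (use step in \<open>auto intro: order_trans\<close>)
    have "a + 1 < L" using b grow[of L] by simp
    \<comment> \<open>The zeros with indices \<open>Z j\<close> and \<open>Z j + a + 1\<close> both
      lie in the window at \<open>j\<close>, so their distance is less than
      \<open>L\<close>.\<close>
    have "\<not> Z j + Z (Z j) < j" using position[of "Z j" j] by simp
    moreover have "(Z j + a + 1) + Z (Z j + a + 1) < j + L" using position[of "Z j + a + 1"] b by simp
    ultimately have short: "Z (Z j + (a + 1)) + a + 1 < Z (Z j) + L" by (simp add: add.assoc)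
    \<comment> \<open>The zero with index \<open>Z i + a\<close> is the first one past the window at
      \<open>i\<close>.\<close>
    have end_i: "i + L \<le> Z i + a + Z (Z i + a)" using position[of "Z i + a" "i + L"] a by simp
    \<comment> \<open>The last zero before \<open>i\<close> has index \<open>t = Z i - 1\<close>;
      its distance to the zero \<open>a + 1\<close> indices later exceeds \<open>L\<close>. If there
      is no such zero then \<open>i = 0\<close>, and index 0 takes the place of
      \<open>t\<close>.\<close>
    show False
    proof (cases "Z i")
      case 0
      then have "i = 0" using position[of 0 i] Z0 by simp
      then have "L \<le> a + Z a" using end_i Z0 by simp
      moreover have "Z a \<le> Z (a + 1)" using mono by (simp add: monoD)
      ultimately show False using less.IH[of "a + 1" "Z j" 0] less.IH[of "a + 1" 0 "Z j"] short \<open>a + 1 < L\<close> Z0 by simp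
    next
      case (Suc t)
      have "t + Z t < i" using position[of t i] Suc by simp
      then have "L + Z t < a + 1 + Z (t + (a + 1))" using end_i Suc by simp
      then show False using less.IH[of "a + 1" t "Z j"] short \<open>a + 1 < L\<close> by simp
    qed
  qed
qed

lemma sublist_map_upt:
  assumes "sublist y (map w [i..<i + n])"
  obtains j where "y = map w [j..<j + length y]"
proof -
  obtain ps ss where eq: "map w [i..<i + n] = ps @ y @ ss" using assms by (auto simp: sublist_def)
  then have "y = take (length y) (drop (length ps) (map w [i..<i + n]))" by simp
  also have "\<dots> = map w [i + length ps..<i + length ps + length y]"
    using arg_cong[OF eq, of length] by (simp add: drop_map take_map)
  finally show ?thesis by (rule that)
qed

text \<open>Over two letters, the number of zeros in a window of given length determines the number
  of ones, so it suffices to compare zeros.\<close>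

lemma fibonacci_balanced:
  assumes "x \<in> infinite_factors fibonacci_word"
  shows "balanced x"
proof -
  define h :: "nat \<Rightarrow> nat list" where "h = (\<lambda>c. if c = 0 then [0, 1] else [0])"
  define f where "f = fibonacci_word"
  define Z where "Z n = count_list (map f [0..<n]) 0" for n
  have ne: "h b \<noteq> []" for b by (simp add: h_def)
  have f: "morphic_image h f = f"
    using fixed_point_from(2)[of h 0 "[1]", OF ne] by (simp add: h_def f_def fibonacci_word_def)
  have ZS: "Z (Suc n) = (if f n = 0 then Suc (Z n) else Z n)" for n by (simp add: Z_def)
  \<comment> \<open>Every letter contributes one letter to the image, and every zero one
    more.\<close>
  have len: "length (concat (map h (map f [0..<n]))) = n + Z n" for n
    by (induction n) (simp_all add: h_def Z_def)
  have image: "f (n + Z n + r) = h (f n) ! r" if "r < length (h (f n))" for n r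
    using morphic_image_nth[of h r f n, OF ne that] unfolding f len .
  have zero: "f (n + Z n) = 0" for n using image[of 0 n] by (simp add: h_def)
  have one: "f (Suc (n + Z n)) = 1" if "f n = 0" for n
    using image[of 1 n] that by (simp add: h_def)
  have mono: "mono Z" by (rule mono_iff_le_Suc[THEN iffD2]) (simp add: ZS)
  \<comment> \<open>Each image contains exactly one zero, namely its first letter.\<close>
  have Z_position: "Z (n + Z n) = n" for n
  proof (induction n)
    case (Suc n)
    then show ?case using zero[of n] one[of n] by (cases "f n = 0") (simp_all add: ZS)
  qed (simp add: Z_def)
  have position: "k + Z k < n \<longleftrightarrow> k < Z n" for k n
  proof
    assume "k + Z k < n"
    then have "Z (Suc (k + Z k)) \<le> Z n" using mono by (simp add: monoD)
    then show "k < Z n" using zero Z_position by (simp add: ZS)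
  next
    assume "k < Z n"
    show "k + Z k < n"
    proof (rule ccontr)
      assume "\<not> k + Z k < n"
      then have "Z n \<le> Z (k + Z k)" using mono by (simp add: monoD)
      then show False using \<open>k < Z n\<close> Z_position by simp
    qed
  qed
  have windows: "Z (j + L) + Z i \<le> Z (i + L) + Z j + 1" for i j L
    by (rule windows_balanced_of_positions[OF mono _ _ position]) (simp_all add: ZS Z_def)
  have count: "count_list (map f [i..<i + n]) 0 + Z i = Z (i + n)" for i n
    by (induction n) (simp_all add: ZS)
  have letters: "f n \<in> {0, 1}" for n
  proof -
    have "f n = concat (map h (map f [0..<Suc n])) ! n"
      using fun_cong[OF f, of n] by (simp add: morphic_image_def del: upt_Suc)
    also have "\<dots> \<in> set (concat (map h (map f [0..<Suc n])))"
      using length_concat_map_ge[of h "map f [0..<Suc n]", OF ne] by (intro nth_mem) simp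
    finally show ?thesis by (auto simp: h_def split: if_splits)
  qed
  have ones: "count_list (map f [i..<i + n]) 0 + count_list (map f [i..<i + n]) (Suc 0) = n" for i n
  proof (induction n)
    case (Suc n)
    then show ?case using letters[of "i + n"] by auto
  qed simp
  have other: "count_list (map f [i..<i + n]) a = 0" if "a \<noteq> 0" "a \<noteq> Suc 0" for i n a
  proof -
    have "f k \<noteq> a" for k using that letters[of k] by auto
    then show ?thesis by (induction n) auto
  qed
  have difference: "\<bar>int (count_list (map f [i..<i + n]) a) - int (count_list (map f [j..<j + n]) a)\<bar> \<le> 1"
    for i j n a
  proof -
    have "\<bar>int (count_list (map f [i..<i + n]) 0) - int (count_list (map f [j..<j + n]) 0)\<bar> \<le> 1"
      using windows[of i n j] windows[of j n i] count[of i n] count[of j n] by linarith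
    then show ?thesis
      using ones[of i n] ones[of j n] other[of a] by (cases "a = 0"; cases "a = Suc 0") auto
  qed
  obtain i n where x: "x = map f [i..<i + n]"
    using assms unfolding infinite_factors_def f_def by blast
  show ?thesis
    unfolding balanced_def
  proof (intro allI impI)
    fix y z a assume "sublist y x" "sublist z x" and len: "length y = length z"
    then obtain j k where "y = map f [j..<j + length y]" "z = map f [k..<k + length z]"
      unfolding x by (metis sublist_map_upt)
    with len difference show "\<bar>int (count_list y a) - int (count_list z a)\<bar> \<le> 1" by metis
  qed
qed

section \<open>Evaluation for the four doubling sequences\<close>

lemma thue_morse_statistics:
  "card (balanced_factors thue_morse) = 41 \<and>
    Max (length ` balanced_factors thue_morse) = 8 \<and>
    (\<forall>n. has_unbalanced_factor_of_length thue_morse n \<longleftrightarrow> n \<ge> 4)"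
proof -
  define h :: "nat \<Rightarrow> nat list" where
    "h = (\<lambda>c. if c = 0 then [0, 1] else [1, 0])"
  define u where "u = fixed_point_from h 0"
  have u: "u 0 = 0" "\<And>n. h (u n) = [u (2 * n), u (Suc (2 * n))]"
    unfolding u_def by (rule fixed_point_from_doubling; simp add: h_def)+
  have "thue_morse = (\<lambda>n. u n)"
    unfolding thue_morse_def u_def h_def by simp
  moreover have "card (balanced_factors (\<lambda>n. u n)) = 41 \<and>
    Max (length ` balanced_factors (\<lambda>n. u n)) = 8 \<and>
    (\<forall>n. has_unbalanced_factor_of_length (\<lambda>n. u n) n \<longleftrightarrow> n \<ge> Suc 3)"
    \<comment> \<open>\<open>J = 6\<close> because the last new pair, 00, first occurs at position
      5. \<open>N\<close> is one more than the longest balanced length, and \<open>k\<close> and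
      \<open>K\<close> are large enough for the length bounds.\<close>
    by (rule statistics[where h = h and u = u and g = "\<lambda>c. c" and J = 6 and K = 6 and k = 3 and N = 9
        and A = "[0, 1]", OF u], unfold h_def) code_simp+
  ultimately show ?thesis by simp
qed

lemma rudin_shapiro_statistics:
  "card (balanced_factors rudin_shapiro) = 157 \<and>
    Max (length ` balanced_factors rudin_shapiro) = 12 \<and>
    (\<forall>n. has_unbalanced_factor_of_length rudin_shapiro n \<longleftrightarrow> n \<ge> 4)"
proof -
  define h :: "nat \<Rightarrow> nat list" where
    "h = (\<lambda>c. if c = 0 then [0, 1] else if c = 1 then [0, 2] else if c = 2 then [3, 1] else [3, 2])"
  define u where "u = fixed_point_from h 0"
  have u: "u 0 = 0" "\<And>n. h (u n) = [u (2 * n), u (Suc (2 * n))]"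
    unfolding u_def by (rule fixed_point_from_doubling; simp add: h_def)+
  have "rudin_shapiro = (\<lambda>n. u n div 2)"
    unfolding rudin_shapiro_def u_def h_def by simp
  moreover have "card (balanced_factors (\<lambda>n. u n div 2)) = 157 \<and>
    Max (length ` balanced_factors (\<lambda>n. u n div 2)) = 12 \<and>
    (\<forall>n. has_unbalanced_factor_of_length (\<lambda>n. u n div 2) n \<longleftrightarrow> n \<ge> Suc 3)"
    \<comment> \<open>The last new pair of the uncoded word, 32, first occurs at position
      12.\<close>
    by (rule statistics[where h = h and u = u and g = "\<lambda>c. c div 2" and J = 13 and K = 8 and k = 4 and N = 13
        and A = "[0, 1]", OF u], unfold h_def) code_simp+
  ultimately show ?thesis by simp
qed

lemma period_doubling_statistics:
  "card (balanced_factors period_doubling) = 69 \<and>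
    Max (length ` balanced_factors period_doubling) = 15 \<and>
    (\<forall>n. has_unbalanced_factor_of_length period_doubling n \<longleftrightarrow> n \<ge> 6)"
proof -
  define h :: "nat \<Rightarrow> nat list" where
    "h = (\<lambda>c. if c = 1 then [1, 0] else [1, 1])"
  define u where "u = fixed_point_from h 1"
  have u: "u 0 = 1" "\<And>n. h (u n) = [u (2 * n), u (Suc (2 * n))]"
    unfolding u_def by (rule fixed_point_from_doubling; simp add: h_def)+
  have "period_doubling = (\<lambda>n. u n)"
    unfolding period_doubling_def u_def h_def by simp
  moreover have "card (balanced_factors (\<lambda>n. u n)) = 69 \<and>
    Max (length ` balanced_factors (\<lambda>n. u n)) = 15 \<and>
    (\<forall>n. has_unbalanced_factor_of_length (\<lambda>n. u n) n \<longleftrightarrow> n \<ge> Suc 5)"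
    \<comment> \<open>The pairs 10, 01, 11 at positions 0 to 2 are all that occur.\<close>
    by (rule statistics[where h = h and u = u and g = "\<lambda>c. c" and J = 3 and K = 6 and k = 4 and N = 16
        and A = "[0, 1]", OF u], unfold h_def) code_simp+
  ultimately show ?thesis by simp
qed

text \<open>
  The pair \<open>(n mod 2, paperfolding n)\<close> is a fixed point of the morphism
  \<open>(a, b) \<mapsto> (0, a) (1, b)\<close>.
\<close>

lemma paperfolding_statistics:
  "card (balanced_factors paperfolding) = 51 \<and>
    Max (length ` balanced_factors paperfolding) = 8 \<and>
    (\<forall>n. has_unbalanced_factor_of_length paperfolding n \<longleftrightarrow> n \<ge> 4)"
proof -
  define h :: "nat \<times> nat \<Rightarrow> (nat \<times> nat) list" where "h = (\<lambda>(a, b). [(0, a), (1, b)])"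
  define u where "u n = (n mod 2, paperfolding n)" for n
  \<comment> \<open>The even positions carry 0 and 1 alternately, so the parity component supplies
    their letters.\<close>
  have even: "paperfolding (2 * n) = n mod 2" for n
  proof (cases "even n")
    case True
    then show ?thesis using paperfolding_rec(2)[of "n div 2"] by auto
  next
    case False
    then obtain q where "n = 2 * q + 1" by (rule oddE)
    then show ?thesis using paperfolding_rec(3)[of q] by simp
  qed
  have u: "u 0 = (0, 0)" "\<And>n. h (u n) = [u (2 * n), u (Suc (2 * n))]"
    using even[of 0] even paperfolding_rec(1) by (simp_all add: u_def h_def)
  have "card (balanced_factors (\<lambda>n. snd (u n))) = 51 \<and>
    Max (length ` balanced_factors (\<lambda>n. snd (u n))) = 8 \<and>
    (\<forall>n. has_unbalanced_factor_of_length (\<lambda>n. snd (u n)) n \<longleftrightarrow> n \<ge> Suc 3)"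
    \<comment> \<open>Each of the four binary pairs occurs at both parities; the eighth combination
      first appears at position 11.\<close>
    by (rule statistics[where h = h and u = u and g = snd and J = 12 and K = 7 and k = 3 and N = 9
        and A = "[0, 1]", OF u], unfold h_def) code_simp+
  then show ?thesis by (simp add: u_def)
qed

theorem theorem12:
  shows
    "(card (balanced_factors thue_morse) = 41 \<and>
      Max (length ` balanced_factors thue_morse) = 8 \<and>
      (\<forall>n. has_unbalanced_factor_of_length thue_morse n \<longleftrightarrow> n \<ge> 4)) \<and>
     (card (balanced_factors rudin_shapiro) = 157 \<and>
      Max (length ` balanced_factors rudin_shapiro) = 12 \<and>
      (\<forall>n. has_unbalanced_factor_of_length rudin_shapiro n \<longleftrightarrow> n \<ge> 4)) \<and>
     (card (balanced_factors paperfolding) = 51 \<and>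
      Max (length ` balanced_factors paperfolding) = 8 \<and>
      (\<forall>n. has_unbalanced_factor_of_length paperfolding n \<longleftrightarrow> n \<ge> 4)) \<and>
     (card (balanced_factors period_doubling) = 69 \<and>
      Max (length ` balanced_factors period_doubling) = 15 \<and>
      (\<forall>n. has_unbalanced_factor_of_length period_doubling n \<longleftrightarrow> n \<ge> 6)) \<and>
     (\<forall>x \<in> infinite_factors fibonacci_word. balanced x)"
  using thue_morse_statistics rudin_shapiro_statistics paperfolding_statistics
    period_doubling_statistics fibonacci_balanced
  by blast

end
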